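(* Let $(M^n,\mu,\tau,v,g,p)$ be an Aristotelian fluid with speed (squared) $s_v=g(v,v)$ and vorticity two-form $\omega_\xi=\mathrm{d}v^\flat$, let $\nabla^{\mathtt A}$ be a linear connection compatible with the Aristotelian structure $(\tau,v,h,\gamma)$, and let $\bar T^{\nabla^{\mathtt A}}=\tau\circ T^{\nabla^{\mathtt A}}$, which is given by $\bar T^{\nabla^{\mathtt A}}=\frac1{s_v}\,\tau\wedge\pounds_vv^\flat=\frac1{s_v}\,\tau\wedge(\iota_v\,\omega_\xi+\mathrm{d}s_v)$. This formula provides a simple criterion for integrability of the underlying $\mathsf{SO}(n-1)$-structure, interpreted as the existence (at first order) of an $\mathsf{SO}(n-1)$-frame moving along the fluid flow: (a) The torsion tensor $\bar T^{\nabla^{\mathtt A}}$ vanishes if and only if $$\pounds_vv^\flat=k\,v^\flat$$ for some function $k\in C^\infty(M^n)$. (b) This condition is satisfied, for instance, when $v$ is a conformal Killing vector field of the Riemannian metric $g$. (c) The condition can be rewritten in terms of the velocity and the vorticity as $$\iota_v\,\omega_\xi+\mathrm{d}s_v=k\,v^\flat .$$ (d) For Aristotelian fluid flows with $\pounds_vs_v=0$, the only solution is $k=0$, and $v$ is a Killing vector field for $g$. It then follows that $\alpha=0$, where $\alpha=\pounds_v\tau$ is the one-form with $\mathrm{d}\tau=\tau\wedge\alpha$, and hence $\mathrm{d}\tau=0$. This implies $\pounds_v\tau=0$, which is consistent with the decomposition $g=h+\tfrac{s_v}{2}\,\tau\otimes\tau$ of the metric.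
   Context: An ideal incompressible fluid on an oriented $n$-manifold $M^n$ ($n\ge2$) consists of a (time-independent) Riemannian metric $g$ with a Riemannian connection $\nabla$, a volume form $\mu$, a one-parameter (time $t$) family of vector fields $v$ (fluid velocity), and a time-dependent function $p$ (pressure), such that $\frac{\partial v}{\partial t}+\nabla_vv=-(\mathrm{d}p)^\sharp$ and $\mathrm{div}_\mu(v)=0$, i.e. $\pounds_v\mu=0$ (with $v$ parallel to $\partial M^n$ if the boundary is non-empty). Here $v^\flat=\iota_vg$ and $\sharp$ denotes the dual vector field with respect to $g$. An Aristotelian fluid $(M^n,\mu,\tau,v,g,p)$ is an ideal incompressible fluid together with one-parameter families of a nowhere-vanishing one-form $\tau$ (clock form) with $\iota_v\tau=1$, a corank one positive-semidefinite symmetric tensor $h\in\Gamma(\odot^2T^*M^n)$ (spatial metric) with $\iota_vh=0$, and a corank one positive-semidefinite symmetric tensor $\gamma\in\Gamma(\odot^2TM^n)$ (spatial cometric) with $\iota_\tau\gamma=0$, such that $\ker(\tau)$ and $\mathrm{Span}(v)$ are $g$-orthogonal, $h$ restricts to $g$ on $\ker\tau$, $\gamma$ restricts to $g^{-1}$ on $\mathrm{Ann}(v)$, and $\tau\wedge\mathrm{d}\tau=0$. In particular $v$ is nowhere-vanishing and $v^\flat=s_v\,\tau$. The one-form $\alpha=\pounds_v\tau$ satisfies $\mathrm{d}\tau=\tau\wedge\alpha$ and $\alpha=\frac1{s_v}\,\iota_v\,\omega_\xi-\frac1{s_v}\,(\pounds_v\log s_v)\,v^\flat+\mathrm{d}\log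 s_v$. The Aristotelian structure $(\tau,v,h,\gamma)$ together with the volume form $\mu$ corresponds to a reduction of the frame bundle of $M^n$ to the group $\mathsf{SO}(n-1)$. A linear connection $\nabla^{\mathtt A}$ is compatible with the Aristotelian structure if it preserves $\tau$, $v$, $h$ and $\gamma$; its torsion is $T^{\nabla^{\mathtt A}}(X,Y)=\nabla^{\mathtt A}_XY-\nabla^{\mathtt A}_YX-[X,Y]$. Everything is at each fixed time.
   Formalization: In (d), "v is a Killing vector field" is false in general and is stated only for conformal Killing v, with £_v g = £_v h given in general; the decomposition is corrected to g = h + s_v τ⊗τ, since the factor s_v/2 contradicts s_v = g(v,v). *)

theory Defs
  imports "HOL-Analysis.Analysis" "HOL-Library.Function_Algebras"
begin

text \<open>
  Smooth manifolds (possibly with boundary) are given by an atlas on a second countable Hausdorff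
  type. Vector fields are the derivations of the algebra of smooth functions, and tensor
  fields are the maps that are multilinear over that algebra. All of these maps are required to
  vanish outside their proper domain, so that equality of HOL functions is equality of sections.
  Sums, products and differences of functions are pointwise (\<open>Function_Algebras\<close>).
\<close>

section \<open>Smooth functions on subsets of a Euclidean space\<close>

fun Ck_on :: "nat \<Rightarrow> ('a::euclidean_space \<Rightarrow> 'b::real_normed_vector) \<Rightarrow> 'a set \<Rightarrow> bool" where
  "Ck_on 0 f U \<longleftrightarrow> continuous_on U f"
| "Ck_on (Suc k) f U \<longleftrightarrow> (\<forall>x\<in>U. f differentiable (at x)) \<and>
     (\<forall>w. Ck_on k (\<lambda>x. frechet_derivative f (at x) w) U)"

text \<open>On a set that is not open, smoothness means local existence of smooth extensions.\<close>

definition smooth_on :: "'a::euclidean_space set \<Rightarrow> ('a \<Rightarrow> 'b::real_normed_vector) \<Rightarrow> bool" where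
  "smooth_on S f \<longleftrightarrow>
     (\<forall>x\<in>S. \<exists>U F. open U \<and> x \<in> U \<and> (\<forall>k. Ck_on k F U) \<and> (\<forall>y\<in>S \<inter> U. F y = f y))"

section \<open>Manifolds with boundary and their smooth functions\<close>

type_synonym ('a, 'e) atlas = "('a set \<times> ('a \<Rightarrow> 'e)) set"

definition halfspace :: "'e::euclidean_space set" where
  "halfspace = {x. 0 \<le> x \<bullet> (SOME b. b \<in> Basis)}"

definition is_chart :: "'a::topological_space set \<Rightarrow> ('a \<Rightarrow> 'e::euclidean_space) \<Rightarrow> bool" where
  "is_chart U \<phi> \<longleftrightarrow> open U \<and> (\<exists>\<psi>. homeomorphism U (\<phi> ` U) \<phi> \<psi>) \<and>
     (open (\<phi> ` U) \<or> openin (top_of_set halfspace) (\<phi> ` U))"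

definition smooth_atlas ::
    "('a::{second_countable_topology, t2_space}, 'e::euclidean_space) atlas \<Rightarrow> bool" where
  "smooth_atlas A \<longleftrightarrow> (\<forall>(U, \<phi>)\<in>A. is_chart U \<phi>) \<and> (\<Union>(U, \<phi>)\<in>A. U) = UNIV \<and>
     (\<forall>(U, \<phi>)\<in>A. \<forall>(V, \<psi>)\<in>A. smooth_on (\<phi> ` (U \<inter> V)) (\<psi> \<circ> inv_into U \<phi>))"

definition boundary :: "('a, 'e::euclidean_space) atlas \<Rightarrow> 'a set" where
  "boundary A = {q. \<exists>(U, \<phi>)\<in>A. q \<in> U \<and> \<phi> q \<notin> interior (\<phi> ` U)}"

definition C_inf :: "('a, 'e::euclidean_space) atlas \<Rightarrow> ('a \<Rightarrow> real) set" where
  "C_inf A = {f. \<forall>(U, \<phi>)\<in>A. smooth_on (\<phi> ` U) (f \<circ> inv_into U \<phi>)}"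

text \<open>Joint smoothness of a family of functions parametrised by the times in \<open>I\<close>.\<close>

definition smooth_family ::
    "('a, 'e::euclidean_space) atlas \<Rightarrow> real set \<Rightarrow> (real \<Rightarrow> 'a \<Rightarrow> real) \<Rightarrow> bool" where
  "smooth_family A I F \<longleftrightarrow>
     (\<forall>(U, \<phi>)\<in>A. smooth_on (I \<times> \<phi> ` U) (\<lambda>(t, x). F t (inv_into U \<phi> x)))"

section \<open>Vector fields, forms and tensors\<close>

type_synonym 'a vfield = "('a \<Rightarrow> real) \<Rightarrow> 'a \<Rightarrow> real"
type_synonym 'a form1 = "'a vfield \<Rightarrow> 'a \<Rightarrow> real"
type_synonym 'a tensor2 = "'a vfield \<Rightarrow> 'a vfield \<Rightarrow> 'a \<Rightarrow> real"
type_synonym 'a cotensor2 = "'a form1 \<Rightarrow> 'a form1 \<Rightarrow> 'a \<Rightarrow> real"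
type_synonym 'a topform = "'a vfield list \<Rightarrow> 'a \<Rightarrow> real"
type_synonym 'a connection = "'a vfield \<Rightarrow> 'a vfield \<Rightarrow> 'a vfield"

definition fsmul :: "('a \<Rightarrow> real) \<Rightarrow> ('i \<Rightarrow> 'a \<Rightarrow> real) \<Rightarrow> 'i \<Rightarrow> 'a \<Rightarrow> real"  (infixr "\<cdot>" 75) where
  "f \<cdot> X = (\<lambda>i. f * X i)"

definition fsmul2 :: "('a \<Rightarrow> real) \<Rightarrow> ('i \<Rightarrow> 'j \<Rightarrow> 'a \<Rightarrow> real) \<Rightarrow> 'i \<Rightarrow> 'j \<Rightarrow> 'a \<Rightarrow> real"
    (infixr "\<cdot>\<cdot>" 75) where
  "f \<cdot>\<cdot> B = (\<lambda>i j. f * B i j)"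

definition fields :: "('a, 'e::euclidean_space) atlas \<Rightarrow> 'a vfield set" where
  "fields A = {X.
     (\<forall>f\<in>C_inf A. X f \<in> C_inf A) \<and>
     (\<forall>f\<in>C_inf A. \<forall>g\<in>C_inf A. X (f + g) = X f + X g) \<and>
     (\<forall>c. \<forall>f\<in>C_inf A. X ((\<lambda>_. c) * f) = (\<lambda>_. c) * X f) \<and>
     (\<forall>f\<in>C_inf A. \<forall>g\<in>C_inf A. X (f * g) = f * X g + g * X f) \<and>
     (\<forall>f. f \<notin> C_inf A \<longrightarrow> X f = 0)}"

text \<open>
  \<open>V\<close> is a module of sections, either the vector fields or the one-forms, and
  \<open>linear_forms A V\<close> is its dual over the smooth functions.
\<close>

definition linear_forms ::
    "('a, 'e::euclidean_space) atlas \<Rightarrow> ('i \<Rightarrow> 'a \<Rightarrow> real) set \<Rightarrow> (('i \<Rightarrow> 'a \<Rightarrow> real) \<Rightarrow> 'a \<Rightarrow> real) set" where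
  "linear_forms A V = {L.
     (\<forall>X\<in>V. L X \<in> C_inf A) \<and>
     (\<forall>X\<in>V. \<forall>Y\<in>V. L (X + Y) = L X + L Y) \<and>
     (\<forall>f\<in>C_inf A. \<forall>X\<in>V. L (f \<cdot> X) = f * L X) \<and>
     (\<forall>X. X \<notin> V \<longrightarrow> L X = 0)}"

definition oneforms :: "('a, 'e::euclidean_space) atlas \<Rightarrow> 'a form1 set" where
  "oneforms A = linear_forms A (fields A)"

definition sym_tensors ::
    "('a, 'e::euclidean_space) atlas \<Rightarrow> ('i \<Rightarrow> 'a \<Rightarrow> real) set \<Rightarrow>
     (('i \<Rightarrow> 'a \<Rightarrow> real) \<Rightarrow> ('i \<Rightarrow> 'a \<Rightarrow> real) \<Rightarrow> 'a \<Rightarrow> real) set" where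
  "sym_tensors A V = {B.
     (\<forall>X\<in>V. B X \<in> linear_forms A V) \<and>
     (\<forall>X\<in>V. \<forall>Y\<in>V. B X Y = B Y X) \<and>
     (\<forall>X. X \<notin> V \<longrightarrow> B X = 0)}"

text \<open>
  The values of two sections at a point agree iff all elements of the dual module take the same
  value on them there.
\<close>

definition same_at ::
    "('a, 'e::euclidean_space) atlas \<Rightarrow> ('i \<Rightarrow> 'a \<Rightarrow> real) set \<Rightarrow> 'a \<Rightarrow>
     ('i \<Rightarrow> 'a \<Rightarrow> real) \<Rightarrow> ('i \<Rightarrow> 'a \<Rightarrow> real) \<Rightarrow> bool" where
  "same_at A V q X Y \<longleftrightarrow> (\<forall>L\<in>linear_forms A V. L X q = L Y q)"

definition pos_semidefinite ::
    "('i \<Rightarrow> 'a \<Rightarrow> real) set \<Rightarrow> (('i \<Rightarrow> 'a \<Rightarrow> real) \<Rightarrow> ('i \<Rightarrow> 'a \<Rightarrow> real) \<Rightarrow> 'a \<Rightarrow> real) \<Rightarrow> bool" where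
  "pos_semidefinite V B \<longleftrightarrow> (\<forall>X\<in>V. \<forall>q. 0 \<le> B X X q)"

text \<open>At every point, the kernel of the bilinear form is a line, spanned by the value of \<open>W\<close>.\<close>

definition corank_one ::
    "('a, 'e::euclidean_space) atlas \<Rightarrow> ('i \<Rightarrow> 'a \<Rightarrow> real) set \<Rightarrow>
     (('i \<Rightarrow> 'a \<Rightarrow> real) \<Rightarrow> ('i \<Rightarrow> 'a \<Rightarrow> real) \<Rightarrow> 'a \<Rightarrow> real) \<Rightarrow> bool" where
  "corank_one A V B \<longleftrightarrow> (\<forall>q. \<exists>W\<in>V. \<not> same_at A V q W 0 \<and>
     (\<forall>X\<in>V. (\<forall>Y\<in>V. B X Y q = 0) \<longleftrightarrow> (\<exists>c. same_at A V q X ((\<lambda>_. c) \<cdot> W))))"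

section \<open>Exterior and Lie calculus\<close>

definition lie_bracket :: "'a vfield \<Rightarrow> 'a vfield \<Rightarrow> 'a vfield" where
  "lie_bracket X Y = (\<lambda>f. X (Y f) - Y (X f))"

definition diff0 :: "('a, 'e::euclidean_space) atlas \<Rightarrow> ('a \<Rightarrow> real) \<Rightarrow> 'a form1" where
  "diff0 A f = (\<lambda>X. if X \<in> fields A then X f else 0)"

definition diff1 :: "('a, 'e::euclidean_space) atlas \<Rightarrow> 'a form1 \<Rightarrow> 'a tensor2" where
  "diff1 A \<alpha> = (\<lambda>X Y. if X \<in> fields A \<and> Y \<in> fields A
     then X (\<alpha> Y) - Y (\<alpha> X) - \<alpha> (lie_bracket X Y) else 0)"

definition wedge11 :: "'a form1 \<Rightarrow> 'a form1 \<Rightarrow> 'a tensor2" where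
  "wedge11 \<alpha> \<beta> = (\<lambda>X Y. \<alpha> X * \<beta> Y - \<alpha> Y * \<beta> X)"

definition wedge12 ::
    "'a form1 \<Rightarrow> 'a tensor2 \<Rightarrow> 'a vfield \<Rightarrow> 'a vfield \<Rightarrow> 'a vfield \<Rightarrow> 'a \<Rightarrow> real" where
  "wedge12 \<alpha> \<omega> = (\<lambda>X Y Z. \<alpha> X * \<omega> Y Z + \<alpha> Y * \<omega> Z X + \<alpha> Z * \<omega> X Y)"

definition tensor11 :: "'a form1 \<Rightarrow> 'a form1 \<Rightarrow> 'a tensor2" where
  "tensor11 \<alpha> \<beta> = (\<lambda>X Y. \<alpha> X * \<beta> Y)"

definition interior_product :: "'x \<Rightarrow> ('x \<Rightarrow> 'y) \<Rightarrow> 'y"  ("\<iota>") where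
  "\<iota> X \<omega> = \<omega> X"

definition lie0 :: "'a vfield \<Rightarrow> ('a \<Rightarrow> real) \<Rightarrow> 'a \<Rightarrow> real" where
  "lie0 X f = X f"

definition lie1 :: "('a, 'e::euclidean_space) atlas \<Rightarrow> 'a vfield \<Rightarrow> 'a form1 \<Rightarrow> 'a form1" where
  "lie1 A X \<alpha> = (\<lambda>Y. if Y \<in> fields A then X (\<alpha> Y) - \<alpha> (lie_bracket X Y) else 0)"

definition lie2 :: "('a, 'e::euclidean_space) atlas \<Rightarrow> 'a vfield \<Rightarrow> 'a tensor2 \<Rightarrow> 'a tensor2" where
  "lie2 A X B = (\<lambda>Y Z. if Y \<in> fields A \<and> Z \<in> fields A
     then X (B Y Z) - B (lie_bracket X Y) Z - B Y (lie_bracket X Z) else 0)"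

section \<open>Volume forms and orientations\<close>

definition topforms :: "('a, 'e::euclidean_space) atlas \<Rightarrow> 'a topform set" where
  "topforms (A :: ('a, 'e) atlas) = {\<mu>.
     (\<forall>Zs. length Zs = DIM('e) \<and> set Zs \<subseteq> fields A \<longrightarrow>
        (\<forall>i<DIM('e). (\<lambda>X. \<mu> (Zs[i := X])) \<in> linear_forms A (fields A)) \<and>
        (\<not> distinct Zs \<longrightarrow> \<mu> Zs = 0)) \<and>
     (\<forall>Zs. \<not> (length Zs = DIM('e) \<and> set Zs \<subseteq> fields A) \<longrightarrow> \<mu> Zs = 0)}"

definition volume_form :: "('a, 'e::euclidean_space) atlas \<Rightarrow> 'a topform \<Rightarrow> bool" where
  "volume_form A \<mu> \<longleftrightarrow> \<mu> \<in> topforms A \<and> (\<forall>q. \<exists>Zs. \<mu> Zs q \<noteq> 0)"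

text \<open>An orientation is a class of volume forms modulo positive functions.\<close>

definition orientation :: "('a, 'e::euclidean_space) atlas \<Rightarrow> 'a topform set \<Rightarrow> bool" where
  "orientation A \<O> \<longleftrightarrow> (\<exists>\<nu>. volume_form A \<nu> \<and> \<O> = {f \<cdot> \<nu> | f. f \<in> C_inf A \<and> (\<forall>q. 0 < f q)})"

definition lie_top :: "('a, 'e::euclidean_space) atlas \<Rightarrow> 'a vfield \<Rightarrow> 'a topform \<Rightarrow> 'a topform" where
  "lie_top (A :: ('a, 'e) atlas) X \<mu> = (\<lambda>Zs. if length Zs = DIM('e) \<and> set Zs \<subseteq> fields A
     then X (\<mu> Zs) - (\<Sum>i<DIM('e). \<mu> (Zs[i := lie_bracket X (Zs ! i)])) else 0)"

section \<open>Riemannian metrics and connections\<close>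

definition riemannian_metric :: "('a, 'e::euclidean_space) atlas \<Rightarrow> 'a tensor2 \<Rightarrow> bool" where
  "riemannian_metric A g \<longleftrightarrow> g \<in> sym_tensors A (fields A) \<and>
     (\<forall>X\<in>fields A. \<forall>q. \<not> same_at A (fields A) q X 0 \<longrightarrow> 0 < g X X q)"

definition flat :: "'a tensor2 \<Rightarrow> 'a vfield \<Rightarrow> 'a form1" where
  "flat g X = \<iota> X g"

definition sharp :: "('a, 'e::euclidean_space) atlas \<Rightarrow> 'a tensor2 \<Rightarrow> 'a form1 \<Rightarrow> 'a vfield" where
  "sharp A g \<alpha> = (THE X. X \<in> fields A \<and> flat g X = \<alpha>)"

definition inverse_metric :: "('a, 'e::euclidean_space) atlas \<Rightarrow> 'a tensor2 \<Rightarrow> 'a cotensor2" where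
  "inverse_metric A g = (\<lambda>\<alpha> \<beta>. g (sharp A g \<alpha>) (sharp A g \<beta>))"

definition speed :: "'a tensor2 \<Rightarrow> 'a vfield \<Rightarrow> 'a \<Rightarrow> real" where
  "speed g v = g v v"

definition vorticity :: "('a, 'e::euclidean_space) atlas \<Rightarrow> 'a tensor2 \<Rightarrow> 'a vfield \<Rightarrow> 'a tensor2" where
  "vorticity A g v = diff1 A (flat g v)"

definition conformal_killing :: "('a, 'e::euclidean_space) atlas \<Rightarrow> 'a tensor2 \<Rightarrow> 'a vfield \<Rightarrow> bool" where
  "conformal_killing A g v \<longleftrightarrow> v \<in> fields A \<and> (\<exists>c\<in>C_inf A. lie2 A v g = c \<cdot>\<cdot> g)"

definition killing :: "('a, 'e::euclidean_space) atlas \<Rightarrow> 'a tensor2 \<Rightarrow> 'a vfield \<Rightarrow> bool" where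
  "killing A g v \<longleftrightarrow> v \<in> fields A \<and> lie2 A v g = 0"

definition linear_connection :: "('a, 'e::euclidean_space) atlas \<Rightarrow> 'a connection \<Rightarrow> bool" where
  "linear_connection A D \<longleftrightarrow>
     (\<forall>X\<in>fields A. \<forall>Y\<in>fields A. D X Y \<in> fields A) \<and>
     (\<forall>X\<in>fields A. \<forall>X'\<in>fields A. \<forall>Y\<in>fields A. D (X + X') Y = D X Y + D X' Y) \<and>
     (\<forall>f\<in>C_inf A. \<forall>X\<in>fields A. \<forall>Y\<in>fields A. D (f \<cdot> X) Y = f \<cdot> D X Y) \<and>
     (\<forall>X\<in>fields A. \<forall>Y\<in>fields A. \<forall>Y'\<in>fields A. D X (Y + Y') = D X Y + D X Y') \<and>
     (\<forall>f\<in>C_inf A. \<forall>X\<in>fields A. \<forall>Y\<in>fields A. D X (f \<cdot> Y) = f \<cdot> D X Y + X f \<cdot> Y)"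

definition torsion :: "'a connection \<Rightarrow> 'a vfield \<Rightarrow> 'a vfield \<Rightarrow> 'a vfield" where
  "torsion D X Y = D X Y - D Y X - lie_bracket X Y"

definition cov1 :: "('a, 'e::euclidean_space) atlas \<Rightarrow> 'a connection \<Rightarrow> 'a vfield \<Rightarrow> 'a form1 \<Rightarrow> 'a form1" where
  "cov1 A D X \<alpha> = (\<lambda>Y. if Y \<in> fields A then X (\<alpha> Y) - \<alpha> (D X Y) else 0)"

definition cov2 :: "('a, 'e::euclidean_space) atlas \<Rightarrow> 'a connection \<Rightarrow> 'a vfield \<Rightarrow> 'a tensor2 \<Rightarrow> 'a tensor2" where
  "cov2 A D X B = (\<lambda>Y Z. if Y \<in> fields A \<and> Z \<in> fields A
     then X (B Y Z) - B (D X Y) Z - B Y (D X Z) else 0)"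

definition cov_co2 ::
    "('a, 'e::euclidean_space) atlas \<Rightarrow> 'a connection \<Rightarrow> 'a vfield \<Rightarrow> 'a cotensor2 \<Rightarrow> 'a cotensor2" where
  "cov_co2 A D X \<gamma> = (\<lambda>\<alpha> \<beta>. if \<alpha> \<in> oneforms A \<and> \<beta> \<in> oneforms A
     then X (\<gamma> \<alpha> \<beta>) - \<gamma> (cov1 A D X \<alpha>) \<beta> - \<gamma> \<alpha> (cov1 A D X \<beta>) else 0)"

definition levi_civita :: "('a, 'e::euclidean_space) atlas \<Rightarrow> 'a tensor2 \<Rightarrow> 'a connection \<Rightarrow> bool" where
  "levi_civita A g D \<longleftrightarrow> linear_connection A D \<and>
     (\<forall>X\<in>fields A. \<forall>Y\<in>fields A. torsion D X Y = 0) \<and> (\<forall>X\<in>fields A. cov2 A D X g = 0)"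

definition aristotelian_connection ::
    "('a, 'e::euclidean_space) atlas \<Rightarrow> 'a form1 \<Rightarrow> 'a vfield \<Rightarrow> 'a tensor2 \<Rightarrow> 'a cotensor2 \<Rightarrow>
     'a connection \<Rightarrow> bool" where
  "aristotelian_connection A \<tau> v h \<gamma> D \<longleftrightarrow> linear_connection A D \<and>
     (\<forall>X\<in>fields A. cov1 A D X \<tau> = 0 \<and> D X v = 0 \<and> cov2 A D X h = 0 \<and> cov_co2 A D X \<gamma> = 0)"

text \<open>The composition of a one-form with the torsion.\<close>

definition clock_torsion ::
    "('a, 'e::euclidean_space) atlas \<Rightarrow> 'a form1 \<Rightarrow> 'a connection \<Rightarrow> 'a tensor2" where
  "clock_torsion A \<tau> D = (\<lambda>X Y. if X \<in> fields A \<and> Y \<in> fields A then \<tau> (torsion D X Y) else 0)"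

section \<open>Fluids\<close>

definition time_derivative ::
    "('a, 'e::euclidean_space) atlas \<Rightarrow> real set \<Rightarrow> (real \<Rightarrow> 'a vfield) \<Rightarrow> real \<Rightarrow> 'a vfield" where
  "time_derivative A I v t = (\<lambda>f q. if f \<in> C_inf A
     then vector_derivative (\<lambda>s. v s f q) (at t within I) else 0)"

text \<open>
  A tangent vector at a boundary point is tangent to the boundary iff it annihilates the smooth
  functions that vanish on the boundary.
\<close>

definition parallel_to_boundary :: "('a, 'e::euclidean_space) atlas \<Rightarrow> 'a vfield \<Rightarrow> bool" where
  "parallel_to_boundary A v \<longleftrightarrow>
     (\<forall>f\<in>C_inf A. (\<forall>q\<in>boundary A. f q = 0) \<longrightarrow> (\<forall>q\<in>boundary A. v f q = 0))"

locale ideal_fluid =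
  fixes A :: "('a::{second_countable_topology, t2_space}, 'e::euclidean_space) atlas"
    and \<O> :: "'a topform set"
    and I :: "real set"
    and \<mu> :: "'a topform"
    and v :: "real \<Rightarrow> 'a vfield"
    and g :: "'a tensor2"
    and D :: "'a connection"
    and p :: "real \<Rightarrow> 'a \<Rightarrow> real"
  assumes dim: "2 \<le> DIM('e)"
    and atlas: "smooth_atlas A"
    and orient: "orientation A \<O>" "\<mu> \<in> \<O>"
    and times: "is_interval I" "interior I \<noteq> {}"
    and metric: "riemannian_metric A g"
    and riemannian_connection: "levi_civita A g D"
    and velocity: "\<And>t. t \<in> I \<Longrightarrow> v t \<in> fields A"
      "\<And>f. f \<in> C_inf A \<Longrightarrow> smooth_family A I (\<lambda>t. v t f)"
    and pressure: "smooth_family A I p"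
    and euler: "\<And>t. t \<in> I \<Longrightarrow>
      time_derivative A I v t + D (v t) (v t) = - sharp A g (diff0 A (p t))"
    and incompressible: "\<And>t. t \<in> I \<Longrightarrow> lie_top A (v t) \<mu> = 0"
    and parallel: "\<And>t. t \<in> I \<Longrightarrow> parallel_to_boundary A (v t)"

locale aristotelian_fluid = ideal_fluid A \<O> I \<mu> v g D p
  for A :: "('a::{second_countable_topology, t2_space}, 'e::euclidean_space) atlas"
    and \<O> I \<mu> v g D p +
  fixes \<tau> :: "real \<Rightarrow> 'a form1"
    and h :: "real \<Rightarrow> 'a tensor2"
    and \<gamma> :: "real \<Rightarrow> 'a cotensor2"
  assumes clock: "\<And>t. t \<in> I \<Longrightarrow> \<tau> t \<in> oneforms A"
      "\<And>X. X \<in> fields A \<Longrightarrow> smooth_family A I (\<lambda>t. \<tau> t X)"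
      "\<And>t q. t \<in> I \<Longrightarrow> \<exists>X\<in>fields A. \<tau> t X q \<noteq> 0"
      "\<And>t. t \<in> I \<Longrightarrow> \<iota> (v t) (\<tau> t) = 1"
    and spatial_metric: "\<And>t. t \<in> I \<Longrightarrow> h t \<in> sym_tensors A (fields A)"
      "\<And>X Y. X \<in> fields A \<Longrightarrow> Y \<in> fields A \<Longrightarrow> smooth_family A I (\<lambda>t. h t X Y)"
      "\<And>t. t \<in> I \<Longrightarrow> corank_one A (fields A) (h t)"
      "\<And>t. t \<in> I \<Longrightarrow> pos_semidefinite (fields A) (h t)"
      "\<And>t. t \<in> I \<Longrightarrow> \<iota> (v t) (h t) = 0"
    and spatial_cometric: "\<And>t. t \<in> I \<Longrightarrow> \<gamma> t \<in> sym_tensors A (oneforms A)"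
      "\<And>\<alpha> \<beta>. \<alpha> \<in> oneforms A \<Longrightarrow> \<beta> \<in> oneforms A \<Longrightarrow> smooth_family A I (\<lambda>t. \<gamma> t \<alpha> \<beta>)"
      "\<And>t. t \<in> I \<Longrightarrow> corank_one A (oneforms A) (\<gamma> t)"
      "\<And>t. t \<in> I \<Longrightarrow> pos_semidefinite (oneforms A) (\<gamma> t)"
      "\<And>t. t \<in> I \<Longrightarrow> \<iota> (\<tau> t) (\<gamma> t) = 0"
    and orthogonal: "\<And>t X q. t \<in> I \<Longrightarrow> X \<in> fields A \<Longrightarrow> \<tau> t X q = 0 \<Longrightarrow> g X (v t) q = 0"
    and restrict_h: "\<And>t X Y q. t \<in> I \<Longrightarrow> X \<in> fields A \<Longrightarrow> Y \<in> fields A \<Longrightarrow>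
      \<tau> t X q = 0 \<Longrightarrow> \<tau> t Y q = 0 \<Longrightarrow> h t X Y q = g X Y q"
    and restrict_\<gamma>: "\<And>t \<alpha> \<beta> q. t \<in> I \<Longrightarrow> \<alpha> \<in> oneforms A \<Longrightarrow> \<beta> \<in> oneforms A \<Longrightarrow>
      \<alpha> (v t) q = 0 \<Longrightarrow> \<beta> (v t) q = 0 \<Longrightarrow> \<gamma> t \<alpha> \<beta> q = inverse_metric A g \<alpha> \<beta> q"
    and frobenius: "\<And>t. t \<in> I \<Longrightarrow> wedge12 (\<tau> t) (diff1 A (\<tau> t)) = 0"

end

theory Submission
  imports Defs
begin

text \<open>
  Because the connection preserves \<open>\<tau>\<close>, the clock torsion is \<open>d\<tau>\<close>, and the Frobenius
  condition evaluated on \<open>v\<close> gives \<open>d\<tau> = \<tau> \<and> \<alpha>\<close> with \<open>\<alpha> = \<pounds>\<^sub>v \<tau>\<close> and \<open>\<alpha>(v) = 0\<close>.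
  Orthogonality forces \<open>v\<^sup>\<flat> = s \<tau>\<close>, hence \<open>\<pounds>\<^sub>v v\<^sup>\<flat> = v(s) \<tau> + s \<alpha>\<close>. As \<open>\<tau>\<close> and \<open>\<alpha>\<close> are independent
  wherever \<open>\<alpha> \<noteq> 0\<close>, this is proportional to \<open>v\<^sup>\<flat>\<close> iff \<open>\<alpha> = 0\<close>, and the factor is then \<open>v(s) / s\<close>.
\<close>

section \<open>Algebra of smooth functions\<close>

lemma Ck_on_subset: "Ck_on k f U \<Longrightarrow> V \<subseteq> U \<Longrightarrow> Ck_on k f V"
proof (induction k arbitrary: f)
  case 0
  then show ?case by (auto intro: continuous_on_subset)
next
  case (Suc k)
  then show ?case by auto
qed

lemma Ck_on_SucD: "Ck_on (Suc k) f U \<Longrightarrow> Ck_on k f U"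
proof (induction k arbitrary: f)
  case 0
  then show ?case
    by (auto intro!: continuous_at_imp_continuous_on differentiable_imp_continuous_within)
next
  case (Suc k)
  then show ?case by simp
qed

text \<open>On an open set the values near a point determine the derivative there. The induction
  runs over all pairs of functions because it passes to directional derivatives.\<close>

lemma Ck_on_cong:
  assumes "open U" "\<And>x. x \<in> U \<Longrightarrow> f x = g x" "Ck_on k f U"
  shows "Ck_on k g U"
  using assms(2,3)
proof (induction k arbitrary: f g)
  case 0
  then show ?case by (auto cong: continuous_on_cong)
next
  case (Suc k)
  have fr: "frechet_derivative f (at x) = frechet_derivative g (at x)" if "x \<in> U" for x
    using Suc.prems that by (intro frechet_derivative_transform_within_open[OF _ assms(1)]) auto
  have "g differentiable (at x)" if "x \<in> U" for x
  proof -
    have "(f has_derivative frechet_derivative f (at x)) (at x)"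
      using Suc.prems(2) that by (simp add: frechet_derivative_works)
    from has_derivative_transform_within_open[OF this assms(1) that] Suc.prems(1)
    show ?thesis unfolding differentiable_def by blast
  qed
  moreover have "Ck_on k (\<lambda>x. frechet_derivative g (at x) w) U" for w
    by (rule Suc.IH[of "\<lambda>x. frechet_derivative f (at x) w"]) (use Suc.prems(2) fr in simp_all)
  ultimately show ?case unfolding Ck_on.simps by blast
qed

text \<open>\<open>Ck_on\<close> is phrased with \<open>frechet_derivative\<close>; uniqueness of
  derivatives lets an explicit formula \<open>f'\<close> take its place, so the usual rules of
  differentiation apply.\<close>

lemma Ck_on_SucI:
  assumes "open U" "\<And>x. x \<in> U \<Longrightarrow> (f has_derivative f' x) (at x)"
    and "\<And>w. Ck_on k (\<lambda>x. f' x w) U"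
  shows "Ck_on (Suc k) f U"
proof -
  have "Ck_on k (\<lambda>x. frechet_derivative f (at x) w) U" for w
    using frechet_derivative_at[OF assms(2)]
    by (intro Ck_on_cong[OF assms(1) _ assms(3)[of w]]) simp
  then show ?thesis using assms(2) by (auto simp: differentiable_def)
qed

lemma has_frechet_derivative:
  "Ck_on (Suc k) f U \<Longrightarrow> x \<in> U \<Longrightarrow> (f has_derivative frechet_derivative f (at x)) (at x)"
  by (simp add: frechet_derivative_works)

lemma Ck_on_const: "Ck_on k (\<lambda>x. c) U"
  by (induction k arbitrary: c) (auto simp: frechet_derivative_const)

lemma Ck_on_add:
  assumes "open U"
  shows "Ck_on k f U \<Longrightarrow> Ck_on k g U \<Longrightarrow> Ck_on k (\<lambda>x. f x + g x) U"
proof (induction k arbitrary: f g)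
  case 0
  then show ?case by (auto intro: continuous_intros)
next
  case (Suc k)
  show ?case
    by (rule Ck_on_SucI[OF assms has_derivative_add[OF Suc.prems[THEN has_frechet_derivative]]])
      (use Suc in auto)
qed

lemma Ck_on_mult:
  fixes f g :: "'a::euclidean_space \<Rightarrow> real"
  assumes "open U"
  shows "Ck_on k f U \<Longrightarrow> Ck_on k g U \<Longrightarrow> Ck_on k (\<lambda>x. f x * g x) U"
proof (induction k arbitrary: f g)
  case 0
  then show ?case by (auto intro: continuous_intros)
next
  case (Suc k)
  \<comment> \<open>The product rule multiplies derivatives of order \<open>k\<close> by
    \<open>f\<close> and \<open>g\<close> themselves, which \<open>Ck_on_SucD\<close> first lowers
    to order \<open>k\<close>.\<close>
  show ?case
    by (rule Ck_on_SucI[OF assms has_derivative_mult[OF Suc.prems[THEN has_frechet_derivative]]])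
      (use Suc.prems Suc.prems[THEN Ck_on_SucD] in \<open>auto intro!: Ck_on_add[OF assms] Suc.IH\<close>)
qed

lemma Ck_on_inverse:
  fixes f :: "'a::euclidean_space \<Rightarrow> real"
  assumes "open U" and nz: "\<And>x. x \<in> U \<Longrightarrow> f x \<noteq> 0"
  shows "Ck_on k f U \<Longrightarrow> Ck_on k (\<lambda>x. inverse (f x)) U"
proof (induction k)
  case 0
  then show ?case using nz by (auto intro: continuous_intros)
next
  case (Suc k)
  have inv: "Ck_on k (\<lambda>x. inverse (f x)) U"
    using Suc Ck_on_SucD by blast
  show ?case
  proof (rule Ck_on_SucI[OF assms(1)])
    \<comment> \<open>The derivative is arranged as a product with the constant -1, so that closure
      under products and constants suffices.\<close>
    show "((\<lambda>x. inverse (f x)) has_derivative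
        (\<lambda>w. (- 1) * (inverse (f x) * frechet_derivative f (at x) w * inverse (f x)))) (at x)"
      if "x \<in> U" for x
      using Deriv.has_derivative_inverse[OF nz[OF that] has_frechet_derivative[OF Suc.prems that]] by simp
    show "Ck_on k (\<lambda>x. (- 1) * (inverse (f x) * frechet_derivative f (at x) w * inverse (f x))) U"
      for w
      using Suc.prems inv by (intro Ck_on_mult[OF assms(1)] Ck_on_const) auto
  qed
qed

section \<open>Smoothness on arbitrary subsets through local extensions\<close>

lemma smooth_onE:
  assumes "smooth_on S f" "x \<in> S"
  obtains U F where "open U" "x \<in> U" "\<And>k. Ck_on k F U" "\<And>y. y \<in> S \<Longrightarrow> y \<in> U \<Longrightarrow> F y = f y"
proof -
  obtain U F where "open U \<and> x \<in> U \<and> (\<forall>k. Ck_on k F U) \<and> (\<forall>y\<in>S \<inter> U. F y = f y)"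
    using bspec[OF assms(1)[unfolded smooth_on_def] assms(2)] by (elim exE)
  then show ?thesis by (intro that[of U F]) simp_all
qed

lemma smooth_onI:
  assumes "\<And>x. x \<in> S \<Longrightarrow>
    \<exists>U F. open U \<and> x \<in> U \<and> (\<forall>k. Ck_on k F U) \<and> (\<forall>y\<in>S \<inter> U. F y = f y)"
  shows "smooth_on S f"
  unfolding smooth_on_def by (intro ballI assms)

lemma smooth_on_binary:
  fixes S :: "'a::euclidean_space set"
  assumes f: "smooth_on S f" and g: "smooth_on S g"
    and op: "\<And>U F G k. open (U :: 'a set) \<Longrightarrow> Ck_on k F U \<Longrightarrow> Ck_on k G U \<Longrightarrow> Ck_on k (\<lambda>x. op (F x) (G x)) U"
  shows "smooth_on S (\<lambda>x. op (f x) (g x))"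
proof (rule smooth_onI)
  fix x assume x: "x \<in> S"
  obtain U F where F: "open U" "x \<in> U" "\<And>k. Ck_on k F U" "\<And>y. y \<in> S \<Longrightarrow> y \<in> U \<Longrightarrow> F y = f y"
    using smooth_onE[OF f x] by metis
  obtain V G where G: "open V" "x \<in> V" "\<And>k. Ck_on k G V" "\<And>y. y \<in> S \<Longrightarrow> y \<in> V \<Longrightarrow> G y = g y"
    using smooth_onE[OF g x] by metis
  have "Ck_on k (\<lambda>x. op (F x) (G x)) (U \<inter> V)" for k
    using F G by (intro op) (auto intro: Ck_on_subset)
  then show "\<exists>W H. open W \<and> x \<in> W \<and> (\<forall>k. Ck_on k H W) \<and> (\<forall>y\<in>S \<inter> W. H y = op (f y) (g y))"
    using F G by (intro exI[of _ "U \<inter> V"] exI[of _ "\<lambda>x. op (F x) (G x)"]) auto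
qed

lemma smooth_on_const: "smooth_on S (\<lambda>x. c)"
  by (intro smooth_onI exI[of _ UNIV] exI[of _ "\<lambda>x. c"]) (simp add: Ck_on_const)

lemma smooth_on_mult:
  fixes f g :: "'a::euclidean_space \<Rightarrow> real"
  shows "smooth_on S f \<Longrightarrow> smooth_on S g \<Longrightarrow> smooth_on S (\<lambda>x. f x * g x)"
  by (rule smooth_on_binary) (auto intro: Ck_on_mult)

lemma smooth_on_diff:
  fixes f g :: "'a::euclidean_space \<Rightarrow> real"
  assumes "smooth_on S f" "smooth_on S g"
  shows "smooth_on S (\<lambda>x. f x - g x)"
proof -
  have "smooth_on S (\<lambda>x. f x + (- 1) * g x)"
    by (rule smooth_on_binary[OF assms(1) smooth_on_mult[OF smooth_on_const assms(2)]])
      (rule Ck_on_add)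
  then show ?thesis by simp
qed

lemma smooth_on_inverse:
  fixes f :: "'a::euclidean_space \<Rightarrow> real"
  assumes f: "smooth_on S f" and nz: "\<And>x. x \<in> S \<Longrightarrow> f x \<noteq> 0"
  shows "smooth_on S (\<lambda>x. inverse (f x))"
proof (rule smooth_onI)
  fix x assume x: "x \<in> S"
  obtain U F where F: "open U" "x \<in> U" "\<And>k. Ck_on k F U" "\<And>y. y \<in> S \<Longrightarrow> y \<in> U \<Longrightarrow> F y = f y"
    using smooth_onE[OF f x] by metis
  \<comment> \<open>The extension may vanish at points of \<open>U\<close> outside \<open>S\<close>,
    so the neighbourhood shrinks to where it is nonzero; it still contains \<open>x\<close> because
    \<open>F x = f x\<close>.\<close>
  define V where "V = U \<inter> F -` (- {0})"
  have "continuous_on U F" using F(3)[of 0] by simp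
  then have V: "open V" unfolding V_def using F(1) by (intro continuous_open_preimage) auto
  have "Ck_on k (\<lambda>x. inverse (F x)) V" for k
    by (rule Ck_on_inverse[OF V]) (auto simp: V_def intro: Ck_on_subset[OF F(3)])
  moreover have "x \<in> V" using F x nz by (auto simp: V_def)
  ultimately show "\<exists>W H. open W \<and> x \<in> W \<and> (\<forall>k. Ck_on k H W) \<and> (\<forall>y\<in>S \<inter> W. H y = inverse (f y))"
    using V F(4) by (intro exI[of _ V] exI[of _ "\<lambda>x. inverse (F x)"]) (auto simp: V_def)
qed

section \<open>Smooth functions on the manifold\<close>

lemma C_infI:
  assumes "\<And>U \<phi>. (U, \<phi>) \<in> A \<Longrightarrow> smooth_on (\<phi> ` U) (\<lambda>x. f (inv_into U \<phi> x))"
  shows "f \<in> C_inf A"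
  using assms unfolding C_inf_def o_def by auto

lemma C_infD:
  assumes "f \<in> C_inf A" "(U, \<phi>) \<in> A"
  shows "smooth_on (\<phi> ` U) (\<lambda>x. f (inv_into U \<phi> x))"
  using assms unfolding C_inf_def o_def by auto

lemma C_inf_mult:
  assumes "f \<in> C_inf A" "g \<in> C_inf A"
  shows "f * g \<in> C_inf A"
  by (rule C_infI) (simp add: smooth_on_mult C_infD[OF assms(1)] C_infD[OF assms(2)])

lemma C_inf_diff:
  assumes "f \<in> C_inf A" "g \<in> C_inf A"
  shows "f - g \<in> C_inf A"
  by (rule C_infI) (simp add: smooth_on_diff C_infD[OF assms(1)] C_infD[OF assms(2)])

lemma C_inf_divide:
  assumes f: "f \<in> C_inf A" and g: "g \<in> C_inf A" and nz: "\<And>q. g q \<noteq> 0"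
  shows "(\<lambda>q. f q / g q) \<in> C_inf A"
  unfolding divide_inverse
  by (rule C_infI) (simp add: smooth_on_mult smooth_on_inverse C_infD[OF f] C_infD[OF g] nz)

lemma C_inf_const: "(\<lambda>_. c) \<in> C_inf A"
  by (rule C_infI) (rule smooth_on_const)

section \<open>Vector fields and tensors\<close>

lemma fieldsD:
  assumes "X \<in> fields A"
  shows "f \<in> C_inf A \<Longrightarrow> X f \<in> C_inf A"
    and "f \<in> C_inf A \<Longrightarrow> g \<in> C_inf A \<Longrightarrow> X (f + g) = X f + X g"
    and "f \<in> C_inf A \<Longrightarrow> X ((\<lambda>_. c) * f) = (\<lambda>_. c) * X f"
    and "f \<in> C_inf A \<Longrightarrow> g \<in> C_inf A \<Longrightarrow> X (f * g) = f * X g + g * X f"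
    and "f \<notin> C_inf A \<Longrightarrow> X f = 0"
  using assms unfolding fields_def by blast+

lemma field_zero: "X \<in> fields A \<Longrightarrow> X 0 = 0"
  using fieldsD(3)[of X A "\<lambda>_. 0" 0] C_inf_const[of 0 A] by (simp add: zero_fun_def times_fun_def)

text \<open>The Leibniz rule for 1 = 1 * 1 gives \<open>X 1 = X 1 + X 1\<close>.\<close>

lemma field_one: "X \<in> fields A \<Longrightarrow> X 1 = 0"
  using fieldsD(4)[of X A 1 1] C_inf_const[of 1 A] by (simp add: one_fun_def[symmetric])

lemma fieldsI:
  assumes "\<And>f. f \<in> C_inf A \<Longrightarrow> X f \<in> C_inf A"
    and "\<And>f k. f \<in> C_inf A \<Longrightarrow> k \<in> C_inf A \<Longrightarrow> X (f + k) = X f + X k"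
    and "\<And>c f. f \<in> C_inf A \<Longrightarrow> X ((\<lambda>_. c) * f) = (\<lambda>_. c) * X f"
    and "\<And>f k. f \<in> C_inf A \<Longrightarrow> k \<in> C_inf A \<Longrightarrow> X (f * k) = f * X k + k * X f"
    and "\<And>f. f \<notin> C_inf A \<Longrightarrow> X f = 0"
  shows "X \<in> fields A"
  using assms unfolding fields_def by blast

lemma fields_diff:
  assumes X: "X \<in> fields A" and Y: "Y \<in> fields A"
  shows "X - Y \<in> fields A"
  by (rule fieldsI)
    (simp_all add: fieldsD[OF X] fieldsD[OF Y] C_inf_diff right_diff_distrib)

lemma fields_fsmul:
  assumes "u \<in> C_inf A" and X: "X \<in> fields A"
  shows "u \<cdot> X \<in> fields A"
  by (rule fieldsI)
    (simp_all add: fsmul_def fieldsD[OF X] C_inf_mult assms distrib_left mult.left_commute)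

lemma fields_lie_bracket:
  assumes X: "X \<in> fields A" and Y: "Y \<in> fields A"
  shows "lie_bracket X Y \<in> fields A"
proof -
  note X' = fieldsD[OF X] and Y' = fieldsD[OF Y]
  have 1: "lie_bracket X Y f \<in> C_inf A" if "f \<in> C_inf A" for f
    unfolding lie_bracket_def by (intro C_inf_diff X'(1) Y'(1) that)
  have 2: "lie_bracket X Y (f + k) = lie_bracket X Y f + lie_bracket X Y k"
    if f: "f \<in> C_inf A" and k: "k \<in> C_inf A" for f k
    unfolding lie_bracket_def X'(2)[OF f k] Y'(2)[OF f k]
      X'(2)[OF Y'(1)[OF f] Y'(1)[OF k]] Y'(2)[OF X'(1)[OF f] X'(1)[OF k]]
    by (rule add_diff_add)
  have 3: "lie_bracket X Y ((\<lambda>_. c) * f) = (\<lambda>_. c) * lie_bracket X Y f"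
    if f: "f \<in> C_inf A" for c f
    unfolding lie_bracket_def X'(3)[OF f] Y'(3)[OF f] X'(3)[OF Y'(1)[OF f]] Y'(3)[OF X'(1)[OF f]]
    by (rule right_diff_distrib[symmetric])
  have 4: "lie_bracket X Y (f * k) = f * lie_bracket X Y k + k * lie_bracket X Y f"
    if f: "f \<in> C_inf A" and k: "k \<in> C_inf A" for f k
  proof -
    \<comment> \<open>Both orders of differentiation produce the same mixed terms
      \<open>X f * Y k\<close> and \<open>X k * Y f\<close>, which cancel in the commutator.\<close>
    have "X (Y (f * k)) = X (f * Y k) + X (k * Y f)"
      by (simp only: Y'(4)[OF f k] X'(2) C_inf_mult f k Y'(1))
    moreover have "Y (X (f * k)) = Y (f * X k) + Y (k * X f)"
      by (simp only: X'(4)[OF f k] Y'(2) C_inf_mult f k X'(1))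
    moreover note X'(4)[OF f Y'(1)[OF k]] X'(4)[OF k Y'(1)[OF f]]
      Y'(4)[OF f X'(1)[OF k]] Y'(4)[OF k X'(1)[OF f]]
    ultimately show ?thesis
      unfolding lie_bracket_def by (simp add: right_diff_distrib)
  qed
  have 5: "lie_bracket X Y f = 0" if "f \<notin> C_inf A" for f
    unfolding lie_bracket_def X'(5)[OF that] Y'(5)[OF that] field_zero[OF X] field_zero[OF Y]
    by simp
  from 1 2 3 4 5 show ?thesis by (rule fieldsI)
qed

lemma lie_bracket_self: "lie_bracket X X = 0"
  by (simp add: lie_bracket_def zero_fun_def)

section \<open>Dual modules and symmetric tensors\<close>

lemma linear_formsD:
  assumes "L \<in> linear_forms A V"
  shows "X \<in> V \<Longrightarrow> L X \<in> C_inf A"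
    and "X \<in> V \<Longrightarrow> Y \<in> V \<Longrightarrow> L (X + Y) = L X + L Y"
    and "f \<in> C_inf A \<Longrightarrow> X \<in> V \<Longrightarrow> L (f \<cdot> X) = f * L X"
    and "X \<notin> V \<Longrightarrow> L X = 0"
  using assms unfolding linear_forms_def by blast+

lemma linear_forms_diff:
  assumes L: "L \<in> linear_forms A (fields A)" and X: "X \<in> fields A" and Y: "Y \<in> fields A"
  shows "L (X - Y) = L X - L Y"
  using linear_formsD(2)[OF L fields_diff[OF X Y] Y] by simp

text \<open>If \<open>0\<close> is a vector field, it is subtracted from itself; otherwise the value
  is 0 by the convention outside the domain.\<close>

lemma linear_forms_zero:
  assumes L: "L \<in> linear_forms A (fields A)"
  shows "L 0 = 0"
  using linear_forms_diff[OF L] linear_formsD(4)[OF L] by (metis diff_self)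

lemma sym_tensorsD:
  assumes "B \<in> sym_tensors A V"
  shows "X \<in> V \<Longrightarrow> B X \<in> linear_forms A V"
    and "B X Y = B Y X"
    and "X \<notin> V \<Longrightarrow> B X = 0"
proof -
  show B: "X \<in> V \<Longrightarrow> B X \<in> linear_forms A V" "X \<notin> V \<Longrightarrow> B X = 0" for X
    using assms unfolding sym_tensors_def by blast+
  have "X \<in> V \<Longrightarrow> Y \<in> V \<Longrightarrow> B X Y = B Y X"
    using assms unfolding sym_tensors_def by blast
  \<comment> \<open>Symmetry extends to all arguments: as soon as one of them lies outside
    \<open>V\<close>, both sides have the default value 0.\<close>
  then show "B X Y = B Y X"
    using B linear_formsD(4) by (metis zero_fun_apply)
qed


section \<open>Exterior derivative, torsion and Cartan's formula\<close>

lemma linear_forms_uminus: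
  assumes L: "L \<in> linear_forms A (fields A)" and X: "X \<in> fields A"
  shows "L (- X) = - L X"
  using linear_forms_diff[OF L fields_diff[OF X X] X] linear_forms_zero[OF L] by simp

lemma lie_bracket_swap: "lie_bracket Y X = - lie_bracket X Y"
  by (simp add: lie_bracket_def fun_eq_iff)

lemma diff1_swap:
  assumes L: "L \<in> linear_forms A (fields A)" and X: "X \<in> fields A" and Y: "Y \<in> fields A"
  shows "diff1 A L Y X = - diff1 A L X Y"
  using linear_forms_uminus[OF L fields_lie_bracket[OF X Y]]
  by (simp add: diff1_def X Y lie_bracket_swap[of Y X])

text \<open>A parallel one-form satisfies \<open>L (D X Y) = X (L Y)\<close>, so applying
  \<open>L\<close> to the torsion reproduces the invariant formula for the exterior derivative of
  \<open>L\<close>.\<close>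

lemma clock_torsion_eq_diff1:
  assumes L: "L \<in> linear_forms A (fields A)" and D: "linear_connection A D"
    and par: "\<And>X. X \<in> fields A \<Longrightarrow> cov1 A D X L = 0"
  shows "clock_torsion A L D = diff1 A L"
proof -
  have D_fields: "D X Y \<in> fields A" if "X \<in> fields A" "Y \<in> fields A" for X Y
    using D that unfolding linear_connection_def by simp
  have L_D: "L (D X Y) = X (L Y)" if "X \<in> fields A" "Y \<in> fields A" for X Y
    using fun_cong[OF par[OF that(1)], of Y] that(2) by (simp add: cov1_def)
  have "L (torsion D X Y) = diff1 A L X Y" if X: "X \<in> fields A" and Y: "Y \<in> fields A" for X Y
  proof -
    have "L (torsion D X Y) = L (D X Y) - L (D Y X) - L (lie_bracket X Y)"
      unfolding torsion_def
      by (simp add: linear_forms_diff[OF L] fields_diff D_fields fields_lie_bracket X Y)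
    then show ?thesis by (simp add: diff1_def L_D X Y)
  qed
  then show ?thesis
    by (simp add: clock_torsion_def diff1_def fun_eq_iff)
qed

text \<open>This is Cartan's formula for the one-form dual to \<open>X\<close>, whose value on
  \<open>X\<close> is the speed: the term \<open>Y (g X X)\<close> of the exterior derivative
  cancels against the differential of the speed.\<close>

lemma lie1_flat_eq:
  assumes g: "g \<in> sym_tensors A (fields A)" and X: "X \<in> fields A"
  shows "\<iota> X (vorticity A g X) + diff0 A (speed g X) = lie1 A X (flat g X)"
proof
  fix Y
  show "(\<iota> X (vorticity A g X) + diff0 A (speed g X)) Y = lie1 A X (flat g X) Y"
    using X by (simp add: interior_product_def vorticity_def diff0_def diff1_def speed_def
      flat_def lie1_def)
qed

section \<open>The clock form of an Aristotelian fluid\<close>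

context aristotelian_fluid
begin

section \<open>Speed, projection along the flow and splitting of the metric at a fixed time\<close>

context
  fixes t
  assumes t: "t \<in> I"
begin

lemma velocity_field: "v t \<in> fields A"
  using velocity(1) t .

lemma metric_sym: "g \<in> sym_tensors A (fields A)"
  using metric by (simp add: riemannian_metric_def)

lemma clock_linear: "\<tau> t \<in> linear_forms A (fields A)"
  using clock(1)[OF t] by (simp add: oneforms_def)

lemma clock_velocity: "\<tau> t (v t) = 1"
  using clock(4)[OF t] by (simp add: interior_product_def)

lemma clock_smooth: "X \<in> fields A \<Longrightarrow> \<tau> t X \<in> C_inf A"
  using linear_formsD(1)[OF clock_linear] .

lemma speed_smooth: "speed g (v t) \<in> C_inf A"
  unfolding speed_def
  using linear_formsD(1)[OF sym_tensorsD(1)[OF metric_sym velocity_field] velocity_field] .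

text \<open>The linear form \<open>\<tau> t\<close> takes the value 1 on the velocity at every point
  and so separates it from 0; the metric is positive definite.\<close>

lemma speed_pos: "0 < speed g (v t) q"
proof -
  have "\<not> same_at A (fields A) q (v t) 0"
    using clock_linear clock_velocity linear_forms_zero[OF clock_linear]
    unfolding same_at_def by (metis one_fun_apply zero_fun_apply zero_neq_one)
  then show ?thesis
    using metric velocity_field unfolding riemannian_metric_def speed_def by blast
qed

text \<open>This is the projection onto the kernel of \<tau> along the velocity. Since the projected
  field is spatial everywhere, the pointwise hypotheses on spatial vectors apply to it at every
  point.\<close>

lemma spatial_part:
  assumes X: "X \<in> fields A"
  shows "X - \<tau> t X \<cdot> v t \<in> fields A" "\<tau> t (X - \<tau> t X \<cdot> v t) = 0"
proof -
  have *: "\<tau> t X \<cdot> v t \<in> fields A"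
    using fields_fsmul[OF clock_smooth[OF X] velocity_field] .
  show "X - \<tau> t X \<cdot> v t \<in> fields A" using fields_diff[OF X *] .
  show "\<tau> t (X - \<tau> t X \<cdot> v t) = 0"
    using linear_forms_diff[OF clock_linear X *]
      linear_formsD(3)[OF clock_linear clock_smooth[OF X] velocity_field] clock_velocity by simp
qed

lemma linear_forms_spatial_part:
  assumes L: "L \<in> linear_forms A (fields A)" and X: "X \<in> fields A"
  shows "L (X - \<tau> t X \<cdot> v t) = L X - \<tau> t X * L (v t)"
  using linear_forms_diff[OF L X fields_fsmul[OF clock_smooth[OF X] velocity_field]]
    linear_formsD(3)[OF L clock_smooth[OF X] velocity_field] by simp

text \<open>The velocity is orthogonal to the spatial part of \<open>X\<close>, so only the
  component \<open>\<tau> t X \<cdot> v t\<close> contributes to its product with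
  \<open>X\<close>.\<close>

lemma flat_velocity: "flat g (v t) = speed g (v t) \<cdot> \<tau> t"
proof
  fix X
  show "flat g (v t) X = (speed g (v t) \<cdot> \<tau> t) X"
  proof (cases "X \<in> fields A")
    case True
    let ?Y = "X - \<tau> t X \<cdot> v t"
    have "g ?Y (v t) q = 0" for q
      using orthogonal[OF t spatial_part(1)[OF True]] spatial_part(2)[OF True] by simp
    then have "g (v t) ?Y = 0"
      using sym_tensorsD(2)[OF metric_sym] by (simp add: fun_eq_iff)
    then show ?thesis
      using linear_forms_spatial_part[OF sym_tensorsD(1)[OF metric_sym velocity_field] True]
      by (simp add: flat_def interior_product_def fsmul_def speed_def mult.commute)
  next
    case False
    then show ?thesis
      using linear_formsD(4)[OF clock_linear]
        linear_formsD(4)[OF sym_tensorsD(1)[OF metric_sym velocity_field]]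
      by (simp add: flat_def interior_product_def fsmul_def)
  qed
qed

text \<open>The tensors \<open>g\<close> and \<open>h t\<close> agree on spatial parts; expanding
  these subtracts the \<tau>-term from \<open>g\<close> and nothing from \<open>h t\<close>, which
  annihilates the velocity. The coefficient is the full speed because
  \<open>tensor11 (\<tau> t) (\<tau> t)\<close> is 1 on two copies of the velocity; a factor 1/2
  would call for a product with value 2 there.\<close>

lemma metric_decomposition: "g = h t + speed g (v t) \<cdot>\<cdot> tensor11 (\<tau> t) (\<tau> t)"
proof (intro ext)
  fix X Y q
  note h = spatial_metric(1)[OF t]
  have v_h: "h t (v t) = 0"
    using spatial_metric(5)[OF t] by (simp add: interior_product_def)
  show "g X Y q = (h t + speed g (v t) \<cdot>\<cdot> tensor11 (\<tau> t) (\<tau> t)) X Y q"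
  proof (cases "X \<in> fields A \<and> Y \<in> fields A")
    case True
    then have X: "X \<in> fields A" and Y: "Y \<in> fields A" by auto
    let ?X = "X - \<tau> t X \<cdot> v t" and ?Y = "Y - \<tau> t Y \<cdot> v t"
    have split: "B ?X ?Y = B X Y - \<tau> t Y * B (v t) X - \<tau> t X * B (v t) Y
        + \<tau> t X * \<tau> t Y * B (v t) (v t)"
      if B: "B \<in> sym_tensors A (fields A)" for B
    proof -
      note lin = linear_forms_spatial_part[OF sym_tensorsD(1)[OF B]]
      note sym = sym_tensorsD(2)[OF B]
      have "B ?X ?Y = B Y ?X - \<tau> t Y * B (v t) ?X"
        using lin[OF spatial_part(1)[OF X] Y] sym by metis
      also have "\<dots> = (B Y X - \<tau> t X * B Y (v t)) - \<tau> t Y * (B (v t) X - \<tau> t X * B (v t) (v t))"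
        using lin[OF Y X] lin[OF velocity_field X] by simp
      finally show ?thesis
        using sym[of Y X] sym[of Y "v t"] by (simp add: algebra_simps)
    qed
    have gv: "g (v t) Z = speed g (v t) * \<tau> t Z" for Z
      using fun_cong[OF flat_velocity] by (simp add: flat_def interior_product_def fsmul_def)
    have "h t ?X ?Y q = g ?X ?Y q"
      using restrict_h[OF t spatial_part(1)[OF X] spatial_part(1)[OF Y]]
        spatial_part(2)[OF X] spatial_part(2)[OF Y] by simp
    then have "h t X Y q = g X Y q - speed g (v t) q * (\<tau> t X q * \<tau> t Y q)"
      unfolding split[OF h] split[OF metric_sym] v_h gv clock_velocity by (simp add: algebra_simps)
    then show ?thesis by (simp add: fsmul2_def tensor11_def)
  next
    case False
    have out: "B X Y = 0" if "B \<in> sym_tensors A (fields A)" for B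
      using False sym_tensorsD(2,3)[OF that] by (metis zero_fun_apply)
    have "\<tau> t X * \<tau> t Y = 0"
      using False linear_formsD(4)[OF clock_linear] by auto
    then show ?thesis
      using out[OF h] out[OF metric_sym] by (simp add: fsmul2_def tensor11_def)
  qed
qed

section \<open>The one-form \<alpha> and the Lie derivative of the dual of the velocity\<close>

lemma lie1_clock_velocity: "lie1 A (v t) (\<tau> t) (v t) = 0"
  by (simp add: lie1_def clock_velocity field_one[OF velocity_field] lie_bracket_self
    linear_forms_zero[OF clock_linear])

lemma diff1_clock: "diff1 A (\<tau> t) = wedge11 (\<tau> t) (lie1 A (v t) (\<tau> t))"
proof (intro ext)
  fix X Y q
  have d_v: "diff1 A (\<tau> t) (v t) Z = lie1 A (v t) (\<tau> t) Z" if "Z \<in> fields A" for Z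
    using that velocity_field by (simp add: diff1_def lie1_def clock_velocity field_one fun_eq_iff)
  show "diff1 A (\<tau> t) X Y q = wedge11 (\<tau> t) (lie1 A (v t) (\<tau> t)) X Y q"
  proof (cases "X \<in> fields A \<and> Y \<in> fields A")
    case True
    then have X: "X \<in> fields A" and Y: "Y \<in> fields A" by auto
    \<comment> \<open>With the velocity in the first slot the coefficient of d\<tau>(X, Y) is 1, and
      the other two terms contain d\<tau> contracted with the velocity, which is \<alpha> up to
      sign.\<close>
    have "wedge12 (\<tau> t) (diff1 A (\<tau> t)) (v t) X Y q = 0"
      by (simp add: frobenius[OF t])
    then show ?thesis
      by (simp add: wedge12_def wedge11_def clock_velocity d_v[OF X] d_v[OF Y]
        diff1_swap[OF clock_linear velocity_field Y])
  next
    case False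
    then show ?thesis
      by (auto simp: diff1_def wedge11_def lie1_def linear_formsD(4)[OF clock_linear])
  qed
qed

lemma lie1_flat_velocity:
  "lie1 A (v t) (flat g (v t)) =
    v t (speed g (v t)) \<cdot> \<tau> t + speed g (v t) \<cdot> lie1 A (v t) (\<tau> t)"
proof
  fix Y
  show "lie1 A (v t) (flat g (v t)) Y =
    (v t (speed g (v t)) \<cdot> \<tau> t + speed g (v t) \<cdot> lie1 A (v t) (\<tau> t)) Y"
  proof (cases "Y \<in> fields A")
    case True
    then show ?thesis
      using fieldsD(4)[OF velocity_field speed_smooth clock_smooth[OF True]]
      by (simp add: lie1_def flat_velocity fsmul_def algebra_simps)
  next
    case False
    then show ?thesis
      by (simp add: lie1_def fsmul_def linear_formsD(4)[OF clock_linear])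
  qed
qed

lemma lie1_flat_velocity_velocity:
  "lie1 A (v t) (flat g (v t)) (v t) = v t (speed g (v t))"
  by (simp add: lie1_flat_velocity fsmul_def clock_velocity lie1_clock_velocity)

lemma lie1_flat_proportional_iff:
  "(\<exists>k\<in>C_inf A. lie1 A (v t) (flat g (v t)) = k \<cdot> flat g (v t)) \<longleftrightarrow> lie1 A (v t) (\<tau> t) = 0"
proof
  assume "\<exists>k\<in>C_inf A. lie1 A (v t) (flat g (v t)) = k \<cdot> flat g (v t)"
  then obtain k where k: "lie1 A (v t) (flat g (v t)) = k \<cdot> flat g (v t)" by (elim bexE)
  \<comment> \<open>Evaluation on the velocity, where \<alpha> vanishes, isolates the factor
    \<open>k\<close>; the \<tau>-terms then cancel and leave speed times \<alpha>.\<close>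
  have vs: "v t (speed g (v t)) = k * speed g (v t)"
    using lie1_flat_velocity_velocity unfolding k
    by (simp add: fsmul_def flat_velocity clock_velocity)
  show "lie1 A (v t) (\<tau> t) = 0"
  proof (intro ext)
    fix Y q
    have "speed g (v t) q * lie1 A (v t) (\<tau> t) Y q = 0"
      using fun_cong[OF fun_cong[OF k[unfolded lie1_flat_velocity vs]], of Y q]
      by (simp add: fsmul_def flat_velocity)
    then show "lie1 A (v t) (\<tau> t) Y q = 0 Y q"
      using speed_pos[of q] by simp
  qed
next
  assume "lie1 A (v t) (\<tau> t) = 0"
  define k where "k = (\<lambda>q. v t (speed g (v t)) q / speed g (v t) q)"
  have nz: "speed g (v t) q \<noteq> 0" for q
    using speed_pos[of q] by simp
  have "k \<in> C_inf A"
    unfolding k_def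
    by (rule C_inf_divide[OF fieldsD(1)[OF velocity_field speed_smooth] speed_smooth nz])
  moreover have "lie1 A (v t) (flat g (v t)) = v t (speed g (v t)) \<cdot> \<tau> t"
    unfolding lie1_flat_velocity \<open>lie1 A (v t) (\<tau> t) = 0\<close> by (simp add: fsmul_def fun_eq_iff)
  moreover have "v t (speed g (v t)) \<cdot> \<tau> t = k \<cdot> flat g (v t)"
    by (simp add: fsmul_def fun_eq_iff flat_velocity k_def nz)
  ultimately show "\<exists>k\<in>C_inf A. lie1 A (v t) (flat g (v t)) = k \<cdot> flat g (v t)"
    by (intro bexI[of _ k]) simp_all
qed

text \<open>Contracting the product of \<tau> and \<alpha> with the velocity returns \<alpha>, since
  \<tau> is 1 and \<alpha> is 0 on it.\<close>

lemma diff1_clock_eq_0_iff: "diff1 A (\<tau> t) = 0 \<longleftrightarrow> lie1 A (v t) (\<tau> t) = 0"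
proof
  assume "diff1 A (\<tau> t) = 0"
  then have "wedge11 (\<tau> t) (lie1 A (v t) (\<tau> t)) (v t) Y = 0" for Y
    by (simp add: diff1_clock[symmetric])
  then show "lie1 A (v t) (\<tau> t) = 0"
    by (simp add: wedge11_def clock_velocity lie1_clock_velocity fun_eq_iff)
next
  assume "lie1 A (v t) (\<tau> t) = 0"
  then show "diff1 A (\<tau> t) = 0"
    unfolding diff1_clock by (simp add: wedge11_def fun_eq_iff)
qed

text \<open>The part of the Lie derivative that is proportional to \<tau> drops out of the wedge
  product, and the rest is speed times \<alpha>.\<close>

lemma diff1_clock_flat:
  "diff1 A (\<tau> t) =
    (\<lambda>q. 1 / speed g (v t) q) \<cdot>\<cdot> wedge11 (\<tau> t) (lie1 A (v t) (flat g (v t)))"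
proof (intro ext)
  fix X Y q
  show "diff1 A (\<tau> t) X Y q =
    ((\<lambda>q. 1 / speed g (v t) q) \<cdot>\<cdot> wedge11 (\<tau> t) (lie1 A (v t) (flat g (v t)))) X Y q"
    using speed_pos[of q]
    by (simp add: diff1_clock lie1_flat_velocity fsmul2_def fsmul_def wedge11_def field_simps)
qed

text \<open>With the velocity in the first slot of the Lie derivative of \<open>g\<close>, the
  bracket of the velocity with itself vanishes and the Lie derivative of the dual one-form remains.
  The conformal factor carries over unchanged.\<close>

lemma conformal_killing_lie1_flat:
  assumes c: "lie2 A (v t) g = c \<cdot>\<cdot> g"
  shows "lie1 A (v t) (flat g (v t)) = c \<cdot> flat g (v t)"
proof
  fix Y
  note lin = sym_tensorsD(1)[OF metric_sym]
  have g0: "g 0 Y = 0"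
    using sym_tensorsD(2)[OF metric_sym, of 0 Y] sym_tensorsD(3)[OF metric_sym, of Y]
      linear_forms_zero[OF lin, of Y] by (cases "Y \<in> fields A") auto
  show "lie1 A (v t) (flat g (v t)) Y = (c \<cdot> flat g (v t)) Y"
  proof (cases "Y \<in> fields A")
    case True
    then show ?thesis
      using fun_cong[OF fun_cong[OF c, of "v t"], of Y] velocity_field
      by (simp add: lie1_def lie2_def flat_def interior_product_def fsmul_def fsmul2_def
        lie_bracket_self g0)
  next
    case False
    then show ?thesis
      using linear_formsD(4)[OF lin[OF velocity_field]]
      by (simp add: lie1_def flat_def interior_product_def fsmul_def)
  qed
qed

text \<open>The speed and \<tau> are both constant along the flow, so the second summand of the
  metric decomposition has zero Lie derivative.\<close>

lemma lie2_metric_eq_lie2_spatial: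
  assumes vs: "v t (speed g (v t)) = 0" and lie: "lie1 A (v t) (\<tau> t) = 0"
  shows "lie2 A (v t) g = lie2 A (v t) (h t)"
proof (intro ext)
  fix Y Z q
  let ?s = "speed g (v t)"
  have g_eq: "g Y Z = h t Y Z + ?s * (\<tau> t Y * \<tau> t Z)" for Y Z
    using fun_cong[OF fun_cong[OF metric_decomposition, of Y], of Z]
    by (simp add: fsmul2_def tensor11_def)
  have v\<tau>: "v t (\<tau> t X) = \<tau> t (lie_bracket (v t) X)" if "X \<in> fields A" for X
    using fun_cong[OF lie, of X] that by (simp add: lie1_def)
  show "lie2 A (v t) g Y Z q = lie2 A (v t) (h t) Y Z q"
  proof (cases "Y \<in> fields A \<and> Z \<in> fields A")
    case True
    then have Y: "Y \<in> fields A" and Z: "Z \<in> fields A" by auto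
    note D = fieldsD[OF velocity_field]
    note smooth = clock_smooth[OF Y] clock_smooth[OF Z]
    have h_smooth: "h t Y Z \<in> C_inf A"
      using linear_formsD(1)[OF sym_tensorsD(1)[OF spatial_metric(1)[OF t] Y] Z] .
    have "v t (g Y Z) = v t (h t Y Z) + v t (?s * (\<tau> t Y * \<tau> t Z))"
      unfolding g_eq[of Y Z]
      by (rule D(2)[OF h_smooth C_inf_mult[OF speed_smooth C_inf_mult[OF smooth]]])
    also have "v t (?s * (\<tau> t Y * \<tau> t Z)) = ?s * v t (\<tau> t Y * \<tau> t Z)"
      unfolding D(4)[OF speed_smooth C_inf_mult[OF smooth]] vs by simp
    also have "v t (\<tau> t Y * \<tau> t Z) =
        \<tau> t Y * \<tau> t (lie_bracket (v t) Z) + \<tau> t Z * \<tau> t (lie_bracket (v t) Y)"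
      unfolding D(4)[OF smooth] v\<tau>[OF Y] v\<tau>[OF Z] ..
    finally have "v t (g Y Z) = v t (h t Y Z) +
        ?s * (\<tau> t Y * \<tau> t (lie_bracket (v t) Z) + \<tau> t Z * \<tau> t (lie_bracket (v t) Y))" .
    then show ?thesis
      using Y Z g_eq[of "lie_bracket (v t) Y" Z] g_eq[of Y "lie_bracket (v t) Z"]
      by (simp add: lie2_def algebra_simps)
  next
    case False
    then show ?thesis by (auto simp: lie2_def)
  qed
qed

end

end

text \<open>In the stationary case the Killing property is concluded for conformal Killing
  velocities. The vanishing of \<open>k\<close> and \<alpha> by itself identifies the Lie derivative
  of \<open>g\<close> with that of \<open>h t\<close>, which need not vanish.\<close>

theorem mainTheorem7:
  fixes A :: "('a::{second_countable_topology, t2_space}, 'e::euclidean_space) atlas"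
    and \<O> :: "'a topform set" and I :: "real set" and \<mu> :: "'a topform"
    and v :: "real \<Rightarrow> 'a vfield" and g :: "'a tensor2" and D DA :: "'a connection"
    and p :: "real \<Rightarrow> 'a \<Rightarrow> real" and \<tau> :: "real \<Rightarrow> 'a form1"
    and h :: "real \<Rightarrow> 'a tensor2" and \<gamma> :: "real \<Rightarrow> 'a cotensor2" and t :: real
  assumes fluid: "aristotelian_fluid A \<O> I \<mu> v g D p \<tau> h \<gamma>"
    and t: "t \<in> I"
    and compatible: "aristotelian_connection A (\<tau> t) (v t) (h t) (\<gamma> t) DA"
  shows
    "clock_torsion A (\<tau> t) DA =
        (\<lambda>q. 1 / speed g (v t) q) \<cdot>\<cdot> wedge11 (\<tau> t) (lie1 A (v t) (flat g (v t)))
     \<and>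
     clock_torsion A (\<tau> t) DA =
        (\<lambda>q. 1 / speed g (v t) q) \<cdot>\<cdot>
          wedge11 (\<tau> t) (\<iota> (v t) (vorticity A g (v t)) + diff0 A (speed g (v t)))
     \<and>
     (clock_torsion A (\<tau> t) DA = 0 \<longleftrightarrow>
        (\<exists>k\<in>C_inf A. lie1 A (v t) (flat g (v t)) = k \<cdot> flat g (v t)))
     \<and>
     (conformal_killing A g (v t) \<longrightarrow>
        (\<exists>k\<in>C_inf A. lie1 A (v t) (flat g (v t)) = k \<cdot> flat g (v t)))
     \<and>
     (\<forall>k\<in>C_inf A.
        lie1 A (v t) (flat g (v t)) = k \<cdot> flat g (v t) \<longleftrightarrow>
        \<iota> (v t) (vorticity A g (v t)) + diff0 A (speed g (v t)) = k \<cdot> flat g (v t))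
     \<and>
     diff1 A (\<tau> t) = wedge11 (\<tau> t) (lie1 A (v t) (\<tau> t))
     \<and>
     g = h t + speed g (v t) \<cdot>\<cdot> tensor11 (\<tau> t) (\<tau> t)
     \<and>
     (lie0 (v t) (speed g (v t)) = 0 \<longrightarrow>
        (\<forall>k\<in>C_inf A. lie1 A (v t) (flat g (v t)) = k \<cdot> flat g (v t) \<longrightarrow>
           k = 0 \<and>
           (conformal_killing A g (v t) \<longrightarrow> killing A g (v t)) \<and>
           lie1 A (v t) (\<tau> t) = 0 \<and>
           diff1 A (\<tau> t) = 0 \<and>
           lie2 A (v t) g = lie2 A (v t) (h t)))"
proof -
  interpret aristotelian_fluid A \<O> I \<mu> v g D p \<tau> h \<gamma> by (rule fluid)
  let ?\<L> = "lie1 A (v t) (flat g (v t))"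
  have torsion: "clock_torsion A (\<tau> t) DA = diff1 A (\<tau> t)"
    using compatible clock_torsion_eq_diff1[OF clock_linear[OF t]]
    unfolding aristotelian_connection_def by simp
  have vorticity: "\<iota> (v t) (vorticity A g (v t)) + diff0 A (speed g (v t)) = ?\<L>"
    using lie1_flat_eq[OF metric_sym velocity_field[OF t]] t by simp
  have conformal: "conformal_killing A g (v t) \<longrightarrow> (\<exists>k\<in>C_inf A. ?\<L> = k \<cdot> flat g (v t))"
  proof
    assume "conformal_killing A g (v t)"
    then obtain c where "c \<in> C_inf A" "lie2 A (v t) g = c \<cdot>\<cdot> g"
      unfolding conformal_killing_def by (elim conjE bexE)
    then show "\<exists>k\<in>C_inf A. ?\<L> = k \<cdot> flat g (v t)"
      using conformal_killing_lie1_flat[OF t] by (intro bexI[of _ c])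
  qed
  have stationary: "lie0 (v t) (speed g (v t)) = 0 \<longrightarrow>
      (\<forall>k\<in>C_inf A. ?\<L> = k \<cdot> flat g (v t) \<longrightarrow>
        k = 0 \<and> (conformal_killing A g (v t) \<longrightarrow> killing A g (v t)) \<and>
        lie1 A (v t) (\<tau> t) = 0 \<and> diff1 A (\<tau> t) = 0 \<and> lie2 A (v t) g = lie2 A (v t) (h t))"
  proof (intro impI ballI)
    fix k
    assume s: "lie0 (v t) (speed g (v t)) = 0" and k: "k \<in> C_inf A" "?\<L> = k \<cdot> flat g (v t)"
    have vs: "v t (speed g (v t)) = 0"
      using s by (simp add: lie0_def)
    \<comment> \<open>On the velocity the equation reads \<open>c\<close> times speed = 0. This
      serves both for \<open>k\<close> and for the conformal factor.\<close>
    have factor_0: "c = 0" if c: "?\<L> = c \<cdot> flat g (v t)" for c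
    proof
      fix q
      have "(c * speed g (v t)) q = 0"
        using lie1_flat_velocity_velocity[OF t]
        unfolding c vs by (simp add: fsmul_def flat_velocity[OF t] clock_velocity[OF t] fun_eq_iff)
      then show "c q = 0 q"
        using speed_pos[OF t, of q] by simp
    qed
    have killing: "killing A g (v t)" if conf: "conformal_killing A g (v t)"
    proof -
      obtain c where c: "lie2 A (v t) g = c \<cdot>\<cdot> g"
        using conf unfolding conformal_killing_def by (elim conjE bexE)
      have "c = 0"
        by (rule factor_0[OF conformal_killing_lie1_flat[OF t c]])
      then show ?thesis
        using c velocity_field[OF t] by (simp add: killing_def fsmul2_def fun_eq_iff)
    qed
    have lie: "lie1 A (v t) (\<tau> t) = 0"
      using lie1_flat_proportional_iff[OF t] k by (metis (no_types))
    show "k = 0 \<and> (conformal_killing A g (v t) \<longrightarrow> killing A g (v t)) \<and>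
        lie1 A (v t) (\<tau> t) = 0 \<and> diff1 A (\<tau> t) = 0 \<and> lie2 A (v t) g = lie2 A (v t) (h t)"
      using diff1_clock_eq_0_iff[OF t] lie
      by (intro conjI impI factor_0[OF k(2)] killing lie2_metric_eq_lie2_spatial[OF t vs lie]) simp_all
  qed
  have torsion_iff: "diff1 A (\<tau> t) = 0 \<longleftrightarrow> (\<exists>k\<in>C_inf A. ?\<L> = k \<cdot> flat g (v t))"
    unfolding diff1_clock_eq_0_iff[OF t] lie1_flat_proportional_iff[OF t] ..
  show ?thesis
    \<comment> \<open>These rewritings make the two torsion formulas coincide and turn the vorticity
      form of the criterion into a reflexive equivalence.\<close>
    unfolding torsion vorticity
    by (intro conjI ballI refl torsion_iff conformal stationary
      diff1_clock_flat[OF t] diff1_clock[OF t] metric_decomposition[OF t])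
qed

end
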